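(* Let $(X,p,E)$ be a lattice-normed vector lattice, $(Y,m,F)$ a lattice-normed vector lattice with an order continuous Banach lattice $(F,\|\cdot\|_F)$, and $(Z,q,G)$ a lattice-normed vector lattice with a Banach lattice $(G,\|\cdot\|_G)$. If $T:X\to Y$ is a sequentially $up$-compact linear operator and $S:Y\to Z$ is a dominated surjective lattice homomorphism, then $S\circ T$ is sequentially $up$-compact.
   Context: All vector lattices are real and Archimedean. A net $(x_\alpha)$ in a vector lattice $X$ order converges to $x$ (written $x_\alpha\xrightarrow{o}x$) if there is a net $(y_\beta)_{\beta\in B}$ (possibly with a different index set) with $y_\beta\downarrow 0$ such that for every $\beta$ there is $\alpha_\beta$ with $|x_\alpha-x|\le y_\beta$ for all $\alpha\ge\alpha_\beta$. A lattice-normed vector lattice (LNVL) is a triple $(X,p,E)$ with $X,E$ vector lattices and $p:X\to E_+$ such that $p(x)=0\Leftrightarrow x=0$, $p(\lambda x)=|\lambda|p(x)$, $p(x+y)\le p(x)+p(y)$, and $|x|\le|y|$ implies $p(x)\le p(y)$. A net $x_\alpha$ in $X$ unbounded $p$-converges to $x$ (written $x_\alpha\xrightarrow{up}x$) if $p(|x_\alpha-x|\wedge u)\xrightarrow{o}0$ in $E$ for all $u\in X_+$. A sequence $x_n$ is $p$-bounded if there is $e\in E$ with $p(x_n)\le e$ for all $n$. A linear operator $T:(X,p,E)\to(Y,m,F)$ is sequentially $up$-compact if for every $p$-bounded sequence $x_n$ in $X$ there are a subsequence $x_{n_k}$ and $y\in Y$ with $Tx_{n_k}\xrightarrow{up}y$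 in $Y$. A linear operator $S:(Y,m,F)\to(Z,q,G)$ is dominated if there is a positive operator $R:F\to G$ with $q(Sy)\le R(m(y))$ for all $y\in Y$. *)

theory Defs
  imports "HOL-Analysis.Analysis" "HOL-Library.Lattice_Algebras"
begin

section \<open>Vector lattices and Banach lattices\<close>

class archimedean_vector_lattice = ordered_real_vector + lattice_ab_group_add_abs +
  assumes archimedean: "(\<And>n::nat. of_nat n *\<^sub>R x \<le> y) \<Longrightarrow> x \<le> 0"

class banach_lattice = archimedean_vector_lattice + banach +
  assumes norm_lattice: "\<bar>x\<bar> \<le> \<bar>y\<bar> \<Longrightarrow> norm x \<le> norm y"


section \<open>Nets and order convergence\<close>

definition directed_set :: "'i set \<Rightarrow> ('i \<Rightarrow> 'i \<Rightarrow> bool) \<Rightarrow> bool" where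
  "directed_set A le \<longleftrightarrow>
     A \<noteq> {} \<and> (\<forall>i\<in>A. le i i) \<and>
     (\<forall>i\<in>A. \<forall>j\<in>A. \<forall>k\<in>A. le i j \<longrightarrow> le j k \<longrightarrow> le i k) \<and>
     (\<forall>i\<in>A. \<forall>j\<in>A. \<exists>k\<in>A. le i k \<and> le j k)"

definition (in order) net_decreases_to ::
    "'i set \<Rightarrow> ('i \<Rightarrow> 'i \<Rightarrow> bool) \<Rightarrow> ('i \<Rightarrow> 'a) \<Rightarrow> 'a \<Rightarrow> bool" where
  "net_decreases_to A le y a \<longleftrightarrow>
     directed_set A le \<and>
     (\<forall>i\<in>A. \<forall>j\<in>A. le i j \<longrightarrow> y j \<le> y i) \<and>
     (\<forall>i\<in>A. a \<le> y i) \<and> (\<forall>z. (\<forall>i\<in>A. z \<le> y i) \<longrightarrow> z \<le> a)"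

text \<open>The dominating net may have an index set of any kind, over which HOL cannot
  quantify.  It is enough to let it be indexed by a directed subset of the type of its
  values, because a decreasing net can be reindexed by its range; see the lemma
  order_convergesI below.\<close>

definition order_converges ::
    "'i set \<Rightarrow> ('i \<Rightarrow> 'i \<Rightarrow> bool) \<Rightarrow> ('i \<Rightarrow> 'a::archimedean_vector_lattice) \<Rightarrow> 'a \<Rightarrow> bool" where
  "order_converges A le x a \<longleftrightarrow>
     directed_set A le \<and>
     (\<exists>(B::'a set) leB (y::'a \<Rightarrow> 'a).
        net_decreases_to B leB y 0 \<and>
        (\<forall>b\<in>B. \<exists>i\<in>A. \<forall>j\<in>A. le i j \<longrightarrow> \<bar>x j - a\<bar> \<le> y b))"

lemma net_decreases_to_range:
  assumes "net_decreases_to B leB y a"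
  shows "net_decreases_to (y ` B) (\<lambda>s t. t \<le> s) id a"
proof -
  have ne: "B \<noteq> {}" and dir: "\<And>i j. i \<in> B \<Longrightarrow> j \<in> B \<Longrightarrow> \<exists>k\<in>B. leB i k \<and> leB j k"
    and anti: "\<And>i j. i \<in> B \<Longrightarrow> j \<in> B \<Longrightarrow> leB i j \<Longrightarrow> y j \<le> y i"
    and lb: "\<And>i. i \<in> B \<Longrightarrow> a \<le> y i"
    and glb: "\<And>z. (\<And>i. i \<in> B \<Longrightarrow> z \<le> y i) \<Longrightarrow> z \<le> a"
    using assms unfolding net_decreases_to_def directed_set_def by blast+
  have dir': "\<exists>k\<in>B. y k \<le> y i \<and> y k \<le> y j" if "i \<in> B" "j \<in> B" for i j
    using dir[OF that] anti that by blast
  have "directed_set (y ` B) (\<lambda>s t. t \<le> s)"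
    unfolding directed_set_def using ne dir'
    by (simp, intro conjI ballI impI) (erule (1) order_trans)
  then show ?thesis
    unfolding net_decreases_to_def using lb glb by simp
qed

lemma order_convergesI:
  fixes B :: "'b set"
  assumes "directed_set A le" and "net_decreases_to B leB y 0"
    and "\<forall>b\<in>B. \<exists>i\<in>A. \<forall>j\<in>A. le i j \<longrightarrow> \<bar>x j - a\<bar> \<le> y b"
  shows "order_converges A le x a"
proof -
  have "\<forall>b\<in>y ` B. \<exists>i\<in>A. \<forall>j\<in>A. le i j \<longrightarrow> \<bar>x j - a\<bar> \<le> id b"
    using assms(3) by simp
  then show ?thesis
    unfolding order_converges_def using assms(1) net_decreases_to_range[OF assms(2)] by blast
qed

text \<open>The axiom speaks of nets indexed by subsets of the space itself; the lemma below
  gives it for nets over arbitrary index types.\<close>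

class order_continuous_banach_lattice = banach_lattice +
  assumes order_continuous_norm_self_indexed:
    "net_decreases_to (A::'a set) le (x::'a \<Rightarrow> 'a) 0 \<Longrightarrow> e > 0 \<Longrightarrow>
       \<exists>i\<in>A. \<forall>j\<in>A. le i j \<longrightarrow> norm (x j) < e"

lemma order_continuous_norm:
  fixes x :: "'i \<Rightarrow> 'a::order_continuous_banach_lattice"
  assumes "net_decreases_to A le x 0" and "e > 0"
  shows "\<exists>i\<in>A. \<forall>j\<in>A. le i j \<longrightarrow> norm (x j) < e"
proof -
  obtain i where "i \<in> A" and *: "\<forall>t\<in>x ` A. t \<le> x i \<longrightarrow> norm t < e"
    using order_continuous_norm_self_indexed[OF net_decreases_to_range[OF assms(1)] assms(2)]
    by auto
  then show ?thesis
    using assms(1) unfolding net_decreases_to_def by blast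
qed


section \<open>Lattice-normed vector lattices\<close>

definition lnvl :: "('x::archimedean_vector_lattice \<Rightarrow> 'e::archimedean_vector_lattice) \<Rightarrow> bool" where
  "lnvl p \<longleftrightarrow>
     (\<forall>x. 0 \<le> p x) \<and>
     (\<forall>x. p x = 0 \<longleftrightarrow> x = 0) \<and>
     (\<forall>c x. p (c *\<^sub>R x) = \<bar>c\<bar> *\<^sub>R p x) \<and>
     (\<forall>x y. p (x + y) \<le> p x + p y) \<and>
     (\<forall>x y. \<bar>x\<bar> \<le> \<bar>y\<bar> \<longrightarrow> p x \<le> p y)"

definition up_converges ::
    "('x::archimedean_vector_lattice \<Rightarrow> 'e::archimedean_vector_lattice) \<Rightarrow>
     'i set \<Rightarrow> ('i \<Rightarrow> 'i \<Rightarrow> bool) \<Rightarrow> ('i \<Rightarrow> 'x) \<Rightarrow> 'x \<Rightarrow> bool" where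
  "up_converges p A le x a \<longleftrightarrow>
     (\<forall>u\<ge>0. order_converges A le (\<lambda>i. p (inf \<bar>x i - a\<bar> u)) 0)"

abbreviation up_converges_seq ::
    "('x::archimedean_vector_lattice \<Rightarrow> 'e::archimedean_vector_lattice) \<Rightarrow>
     (nat \<Rightarrow> 'x) \<Rightarrow> 'x \<Rightarrow> bool" where
  "up_converges_seq p x a \<equiv> up_converges p UNIV (\<le>) x a"

definition p_bounded ::
    "('x::archimedean_vector_lattice \<Rightarrow> 'e::archimedean_vector_lattice) \<Rightarrow> (nat \<Rightarrow> 'x) \<Rightarrow> bool" where
  "p_bounded p x \<longleftrightarrow> (\<exists>e. \<forall>n. p (x n) \<le> e)"


section \<open>Operators\<close>

definition sequentially_up_compact ::
    "('x::archimedean_vector_lattice \<Rightarrow> 'e::archimedean_vector_lattice) \<Rightarrow>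
     ('y::archimedean_vector_lattice \<Rightarrow> 'f::archimedean_vector_lattice) \<Rightarrow> ('x \<Rightarrow> 'y) \<Rightarrow> bool" where
  "sequentially_up_compact p m T \<longleftrightarrow>
     linear T \<and>
     (\<forall>x. p_bounded p x \<longrightarrow>
        (\<exists>r y. strict_mono r \<and> up_converges_seq m (\<lambda>k. T (x (r k))) y))"

definition positive_operator ::
    "('e::archimedean_vector_lattice \<Rightarrow> 'f::archimedean_vector_lattice) \<Rightarrow> bool" where
  "positive_operator R \<longleftrightarrow> linear R \<and> (\<forall>x\<ge>0. 0 \<le> R x)"

definition dominated ::
    "('y::archimedean_vector_lattice \<Rightarrow> 'f::archimedean_vector_lattice) \<Rightarrow>
     ('z::archimedean_vector_lattice \<Rightarrow> 'g::archimedean_vector_lattice) \<Rightarrow> ('y \<Rightarrow> 'z) \<Rightarrow> bool" where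
  "dominated m q S \<longleftrightarrow>
     linear S \<and> (\<exists>R. positive_operator R \<and> (\<forall>y. q (S y) \<le> R (m y)))"

definition lattice_homomorphism ::
    "('y::archimedean_vector_lattice \<Rightarrow> 'z::archimedean_vector_lattice) \<Rightarrow> bool" where
  "lattice_homomorphism S \<longleftrightarrow> linear S \<and> (\<forall>x y. S (sup x y) = sup (S x) (S y))"

end

theory Submission
  imports Defs
begin

text \<open>A positive operator \<open>R\<close> from an order continuous Banach lattice is order continuous:
  if \<open>y\<close> decreases to 0 and \<open>z \<le> R (y b)\<close> for all \<open>b\<close>, choose \<open>b n\<close> so that the series
  \<open>\<Sum>n. n *\<^sub>R y (b n)\<close> converges, say to \<open>w\<close>; then \<open>n *\<^sub>R z \<le> R w\<close> for every \<open>n\<close>, and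
  \<open>z \<le> 0\<close> by the Archimedean property. Domination therefore carries the order convergence
  of \<open>m (inf \<bar>T x - y\<bar> v)\<close> over to \<open>q (inf \<bar>S (T x) - S y\<bar> (S v))\<close>, along the same
  subsequence for all \<open>v\<close>, and by surjectivity every \<open>u \<ge> 0\<close> is \<open>S v\<close> for some \<open>v \<ge> 0\<close>.\<close>

text \<open>The positive cone is norm closed: as soon as \<open>x n\<close> is nonnegative, the
  negative part \<open>sup 0 (- a)\<close> lies below \<open>\<bar>x n - a\<bar>\<close>, so its
  norm is at most that of \<open>x n - a\<close>, which tends to 0.\<close>

lemma tendsto_nonneg_banach_lattice:
  fixes x :: "nat \<Rightarrow> 'a::banach_lattice"
  assumes lim: "x \<longlonglongrightarrow> a" and nonneg: "\<forall>\<^sub>F n in sequentially. 0 \<le> x n"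
  shows "0 \<le> a"
proof -
  have "norm (sup 0 (- a)) \<le> norm (x n - a)" if "0 \<le> x n" for n
  proof (rule norm_lattice)
    have "- a \<le> x n - a"
      using that by simp
    also have "\<dots> \<le> \<bar>x n - a\<bar>"
      by (rule abs_ge_self)
    finally have "sup 0 (- a) \<le> \<bar>x n - a\<bar>"
      by simp
    moreover have "0 \<le> sup 0 (- a)"
      by simp
    ultimately show "\<bar>sup 0 (- a)\<bar> \<le> \<bar>x n - a\<bar>"
      by (simp only: abs_of_nonneg)
  qed
  then have "\<forall>\<^sub>F n in sequentially. norm (sup 0 (- a)) \<le> norm (x n - a)"
    using nonneg by (auto elim: eventually_mono)
  moreover have "(\<lambda>n. norm (x n - a)) \<longlonglongrightarrow> 0"
    using lim by (simp add: LIM_zero tendsto_norm_zero)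
  ultimately have "norm (sup 0 (- a)) \<le> 0"
    by (intro tendsto_lowerbound[of "\<lambda>n. norm (x n - a)" 0 sequentially]) auto
  then have "sup 0 (- a) = 0"
    by simp
  then have "- a \<le> 0"
    by (metis sup_ge2)
  then show ?thesis
    by simp
qed

text \<open>For \<open>k > n\<close> the partial sum contains \<open>f n\<close> and otherwise only
  nonnegative terms; closedness of the cone carries the inequality over to the limit.\<close>

lemma term_le_suminf_banach_lattice:
  fixes f :: "nat \<Rightarrow> 'a::banach_lattice"
  assumes "summable f" and nonneg: "\<And>n. 0 \<le> f n"
  shows "f n \<le> suminf f"
proof -
  have "(\<lambda>k. (\<Sum>i<k. f i) - f n) \<longlonglongrightarrow> suminf f - f n"
    by (intro tendsto_diff tendsto_const summable_LIMSEQ assms)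
  moreover have "f n \<le> (\<Sum>i<k. f i)" if "n < k" for k
    using that nonneg sum_mono2[of "{..<k}" "{n}" f] by simp
  then have "\<forall>\<^sub>F k in sequentially. 0 \<le> (\<Sum>i<k. f i) - f n"
    using eventually_mono[OF eventually_gt_at_top[of n]] by simp
  ultimately have "0 \<le> suminf f - f n"
    by (rule tendsto_nonneg_banach_lattice)
  then show ?thesis
    by simp
qed

lemma positive_operator_mono:
  assumes "positive_operator R" and "x \<le> y"
  shows "R x \<le> R y"
proof -
  have "0 \<le> R (y - x)"
    using assms by (simp add: positive_operator_def)
  then show ?thesis
    using assms(1) by (simp add: positive_operator_def linear_diff)
qed

lemma positive_operator_net_decreases_to:
  fixes R :: "'f::order_continuous_banach_lattice \<Rightarrow> 'g::archimedean_vector_lattice"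
  assumes R: "positive_operator R" and y: "net_decreases_to B le y 0"
  shows "net_decreases_to B le (\<lambda>b. R (y b)) 0"
proof -
  have lin: "linear R" and pos: "\<And>x. 0 \<le> x \<Longrightarrow> 0 \<le> R x"
    using R by (auto simp: positive_operator_def)
  have dir: "directed_set B le" and y_nonneg: "\<And>b. b \<in> B \<Longrightarrow> 0 \<le> y b"
    using y by (auto simp: net_decreases_to_def)
  have "z \<le> 0" if z: "\<forall>b\<in>B. z \<le> R (y b)" for z
  proof -
    have "\<exists>b\<in>B. norm (real n *\<^sub>R y b) \<le> (1/2) ^ n" for n
    proof -
      \<comment> \<open>The denominator \<open>real n + 1\<close> is positive even for
        \<open>n = 0\<close> and still absorbs the factor \<open>real n\<close>. The bound
        \<open>(1/2) ^ n\<close> is summable, which will give absolute convergence of the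
        series.\<close>
      obtain b where "b \<in> B" and *: "\<forall>j\<in>B. le b j \<longrightarrow> norm (y j) < (1/2) ^ n / (real n + 1)"
        using order_continuous_norm[OF y, of "(1/2) ^ n / (real n + 1)"] by auto
      moreover have "le b b"
        using dir \<open>b \<in> B\<close> by (auto simp: directed_set_def)
      ultimately have "norm (y b) < (1/2) ^ n / (real n + 1)"
        by blast
      then have "(real n + 1) * norm (y b) < (1/2) ^ n"
        by (simp add: pos_less_divide_eq mult.commute)
      then have "norm (real n *\<^sub>R y b) \<le> (1/2) ^ n"
        using norm_ge_zero[of "y b"] by (simp add: distrib_right del: norm_ge_zero)
      with \<open>b \<in> B\<close> show ?thesis ..
    qed
    then obtain b where b: "\<And>n. b n \<in> B"
      and small: "\<And>n. norm (real n *\<^sub>R y (b n)) \<le> (1/2) ^ n"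
      by metis
    define f where "f n = real n *\<^sub>R y (b n)" for n
    have "summable f"
      using small by (intro summable_comparison_test'[of "\<lambda>n. (1/2) ^ n" 0 f]) (auto simp: f_def)
    moreover have "0 \<le> f n" for n
      using y_nonneg b by (simp add: f_def scaleR_nonneg_nonneg)
    ultimately have f_le: "f n \<le> suminf f" for n
      by (rule term_le_suminf_banach_lattice)
    have "real n *\<^sub>R z \<le> R (suminf f)" for n
    proof -
      have "real n *\<^sub>R z \<le> real n *\<^sub>R R (y (b n))"
        using z b by (intro scaleR_left_mono) auto
      also have "\<dots> = R (f n)"
        using lin by (simp add: f_def linear_scale)
      also have "\<dots> \<le> R (suminf f)"
        using R f_le by (rule positive_operator_mono)
      finally show ?thesis .
    qed
    then show ?thesis
      by (rule archimedean)
  qed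
  with y R pos show ?thesis
    by (auto simp: net_decreases_to_def intro: positive_operator_mono)
qed

text \<open>If \<open>y\<close> dominates \<open>x\<close>, then \<open>R\<close> composed with
  \<open>y\<close> dominates \<open>z\<close>. This net takes values in \<open>'g\<close> but keeps
  its index set in \<open>'f\<close>, hence the appeal to \<open>order_convergesI\<close>, which
  allows any index type.\<close>

lemma order_converges_dominated:
  fixes R :: "'f::order_continuous_banach_lattice \<Rightarrow> 'g::archimedean_vector_lattice"
  assumes R: "positive_operator R" and x: "order_converges A le x 0"
    and bound: "\<And>i. \<bar>z i\<bar> \<le> R \<bar>x i\<bar>"
  shows "order_converges A le z 0"
proof -
  obtain B leB y where dir: "directed_set A le"
    and y: "net_decreases_to (B :: 'f set) leB (y :: 'f \<Rightarrow> 'f) 0"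
    and dom: "\<forall>b\<in>B. \<exists>i\<in>A. \<forall>j\<in>A. le i j \<longrightarrow> \<bar>x j - 0\<bar> \<le> y b"
    using x unfolding order_converges_def by blast
  have "\<bar>z j - 0\<bar> \<le> R (y b)" if "\<bar>x j - 0\<bar> \<le> y b" for j b
    using order_trans[OF bound[of j]] positive_operator_mono[OF R that] by simp
  with dom have "\<forall>b\<in>B. \<exists>i\<in>A. \<forall>j\<in>A. le i j \<longrightarrow> \<bar>z j - 0\<bar> \<le> R (y b)"
    by meson
  with dir positive_operator_net_decreases_to[OF R y] show ?thesis
    by (rule order_convergesI)
qed

lemma lattice_homomorphism_abs:
  assumes "lattice_homomorphism S"
  shows "S \<bar>x\<bar> = \<bar>S x\<bar>"
  using assms unfolding lattice_homomorphism_def abs_lattice by (metis linear_neg)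

text \<open>An infimum is minus the supremum of the negatives, so linearity and preservation of
  \<open>sup\<close> suffice.\<close>

lemma lattice_homomorphism_inf:
  assumes "lattice_homomorphism S"
  shows "S (inf x y) = inf (S x) (S y)"
  using assms unfolding lattice_homomorphism_def inf_eq_neg_sup by (metis linear_neg)

lemma up_converges_lattice_homomorphism:
  fixes m :: "'y::archimedean_vector_lattice \<Rightarrow> 'f::order_continuous_banach_lattice"
    and q :: "'z::archimedean_vector_lattice \<Rightarrow> 'g::archimedean_vector_lattice"
  assumes m: "lnvl m" and q: "lnvl q" and dom: "dominated m q S"
    and surj: "surj S" and hom: "lattice_homomorphism S"
    and x: "up_converges m A le x a"
  shows "up_converges q A le (\<lambda>i. S (x i)) (S a)"
  unfolding up_converges_def
proof (intro allI impI)
  fix u :: 'z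
  assume "0 \<le> u"
  obtain v where "u = S v"
    using surj by blast
  \<comment> \<open>Since \<open>u\<close> is nonnegative,
    \<open>u = \<bar>S v\<bar> = S \<bar>v\<bar>\<close>. A nonnegative preimage is needed because
    the convergence of \<open>x\<close> is tested only against nonnegative elements.\<close>
  with \<open>0 \<le> u\<close> have u: "u = S \<bar>v\<bar>"
    by (simp add: lattice_homomorphism_abs[OF hom])
  obtain R where R: "positive_operator R" and qR: "\<And>y. q (S y) \<le> R (m y)"
    using dom by (auto simp: dominated_def)
  have nonneg: "0 \<le> m y" "0 \<le> q w" for y w
    using m q by (auto simp: lnvl_def)
  have "inf \<bar>S (x i) - S a\<bar> u = S (inf \<bar>x i - a\<bar> \<bar>v\<bar>)" for i
    using hom by (simp add: u lattice_homomorphism_inf lattice_homomorphism_abs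
        lattice_homomorphism_def linear_diff)
  \<comment> \<open>Values of \<open>m\<close> and \<open>q\<close> are nonnegative, so the absolute
    values change nothing; they give the bound the form required by
    \<open>order_converges_dominated\<close>.\<close>
  then have "\<bar>q (inf \<bar>S (x i) - S a\<bar> u)\<bar> \<le> R \<bar>m (inf \<bar>x i - a\<bar> \<bar>v\<bar>)\<bar>" for i
    using qR nonneg by simp
  moreover have "order_converges A le (\<lambda>i. m (inf \<bar>x i - a\<bar> \<bar>v\<bar>)) 0"
    using x by (simp add: up_converges_def)
  ultimately show "order_converges A le (\<lambda>i. q (inf \<bar>S (x i) - S a\<bar> u)) 0"
    using R by (blast intro: order_converges_dominated)
qed

theorem theorem8:
  fixes p :: "'x::archimedean_vector_lattice \<Rightarrow> 'e::archimedean_vector_lattice"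
    and m :: "'y::archimedean_vector_lattice \<Rightarrow> 'f::order_continuous_banach_lattice"
    and q :: "'z::archimedean_vector_lattice \<Rightarrow> 'g::banach_lattice"
    and T :: "'x \<Rightarrow> 'y" and S :: "'y \<Rightarrow> 'z"
  assumes "lnvl p" and "lnvl m" and "lnvl q"
    and "sequentially_up_compact p m T"
    and "dominated m q S" and "surj S" and "lattice_homomorphism S"
  shows "sequentially_up_compact p q (S \<circ> T)"
  unfolding sequentially_up_compact_def
proof (intro conjI allI impI)
  show "linear (S \<circ> T)"
    using assms(4,5) by (simp add: sequentially_up_compact_def dominated_def linear_compose)
next
  fix x :: "nat \<Rightarrow> 'x"
  assume "p_bounded p x"
  then obtain r y where "strict_mono r" and "up_converges_seq m (\<lambda>k. T (x (r k))) y"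
    using assms(4) by (auto simp: sequentially_up_compact_def)
  \<comment> \<open>The subsequence \<open>r\<close> chosen for \<open>T\<close> serves again, and
    the new limit is the image \<open>S y\<close>.\<close>
  then have "up_converges_seq q (\<lambda>k. (S \<circ> T) (x (r k))) (S y)"
    using up_converges_lattice_homomorphism[OF assms(2,3,5-7)] by simp
  with \<open>strict_mono r\<close>
  show "\<exists>r y. strict_mono r \<and> up_converges_seq q (\<lambda>k. (S \<circ> T) (x (r k))) y"
    by blast
qed

end
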